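(* Let $\delta\in(0,1/4)$ be fixed, and let $Y$ and $L$ be as defined in the context. Suppose $(p_m,q_m)$, $m=1,2,\dots$, is a sequence of points in $\mathbb{R}^2$ and $\alpha\in\mathbb{R}$ are such that for all $m$ $$Y(p_m,q_m)=0,\qquad |p_m|>x_M,\qquad q_m\neq 0,\qquad \left|\frac{q_m}{p_m}\right|<1-2\delta,$$ and $|p_m|\to\infty$, $\lim_{m\to\infty}\frac{q_m}{p_m}=\alpha$. Then $$\frac{d^L}{dz^L}\left(\frac{z^{L+2}}{(1+z^2)^{3/2}}\right)\bigg|_{z=\alpha}=0.$$
   Context: Let $M\ge1$, let $0<x_1<x_2<\cdots<x_M$ be real numbers and let $a_1,\dots,a_M$ be real numbers, not all zero. For $(x,y)\in\mathbb{R}^2\setminus\{(x_1,0),\dots,(x_M,0)\}$ let $$Y(x,y)=\sum_{j=1}^M\frac{a_jy}{((x-x_j)^2+y^2)^{3/2}}.$$ Let $\mu_k=\sum_{j=1}^M a_jx_j^k$ for $k=0,1,\dots$. The integer $L$, $0\le L\le M-1$, is the unique integer such that $\mu_k=0$ for $k=0,1,\dots,L-1$ and $\mu_L\neq0$ (it exists by the non-vanishing of Vandermonde determinants). The $0$th derivative of a function is the function itself. *)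

theory Defs
  imports "HOL-Analysis.Analysis"
begin

text \<open>The finite families \<open>x\<^sub>1, \<dots>, x\<^sub>M\<close> and \<open>a\<^sub>1, \<dots>, a\<^sub>M\<close> are functions on
  \<^typ>\<open>nat\<close> of which only the values at indices \<open>1, \<dots>, M\<close> are used.\<close>

text \<open>At the excluded points \<open>(x\<^sub>j, 0)\<close> the value below is a convention
  (division by zero) without mathematical meaning.\<close>

definition Y :: "nat \<Rightarrow> (nat \<Rightarrow> real) \<Rightarrow> (nat \<Rightarrow> real) \<Rightarrow> real \<Rightarrow> real \<Rightarrow> real" where
  "Y M x a u v = (\<Sum>j=1..M. a j * v / ((u - x j)\<^sup>2 + v\<^sup>2) powr (3/2))"

definition moment :: "nat \<Rightarrow> (nat \<Rightarrow> real) \<Rightarrow> (nat \<Rightarrow> real) \<Rightarrow> nat \<Rightarrow> real" where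
  "moment M x a k = (\<Sum>j=1..M. a j * x j ^ k)"

text \<open>A definite description: it denotes when the \<open>x\<^sub>j\<close> are distinct and the \<open>a\<^sub>j\<close> are not all
  zero, by the non-vanishing of Vandermonde determinants.\<close>

definition first_moment_index :: "nat \<Rightarrow> (nat \<Rightarrow> real) \<Rightarrow> (nat \<Rightarrow> real) \<Rightarrow> nat" where
  "first_moment_index M x a =
     (THE L. L \<le> M - 1 \<and> (\<forall>k<L. moment M x a k = 0) \<and> moment M x a L \<noteq> 0)"

end

theory Submission
  imports Defs
begin

text \<open>
  Dividing \<open>Y(p, q)\<close> by \<open>q / |q|^3\<close> gives, with \<open>\<phi>(w) = (1 + w\<^sup>2) powr (-3/2)\<close>, the sum
  \<open>\<Sum>j. a\<^sub>j \<phi>(p/q - x\<^sub>j/q)\<close>. If \<open>\<alpha> \<noteq> 0\<close>, then along the given sequence \<open>p/q\<close> tends to \<open>1/\<alpha>\<close>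
  and the increments \<open>x\<^sub>j/q\<close> tend to \<open>0\<close>. In the Taylor expansion of \<open>\<phi>\<close> at \<open>p/q\<close> the term of
  order \<open>k\<close> carries the factor \<open>\<mu>\<^sub>k\<close>, so all terms below order \<open>L\<close> cancel. The remainder, divided
  by \<open>(-1/q)^L / L!\<close>, is \<open>\<Sum>j. a\<^sub>j x\<^sub>j^L \<phi>\<^sup>(\<^sup>L\<^sup>)(\<xi>\<^sub>j)\<close> with \<open>\<xi>\<^sub>j\<close> tending to \<open>1/\<alpha>\<close>. The zeros of \<open>Y\<close>
  therefore force \<open>\<mu>\<^sub>L \<phi>\<^sup>(\<^sup>L\<^sup>)(1/\<alpha>) = 0\<close> (lemma \<open>moment_mult_deriv_eq_0\<close>), that is,
  \<open>\<phi>\<^sup>(\<^sup>L\<^sup>)(1/\<alpha>) = 0\<close>.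

  For \<open>z > 0\<close> the function \<open>z^(L + 2) (1 + z\<^sup>2) powr (-3/2)\<close> is \<open>z^(L - 1) \<phi>(1/z)\<close>, and the classical
  identity
  \<open>(d/dz)^L (z^(L - 1) \<phi>(1/z)) = (-1)^L z^(-L - 1) \<phi>\<^sup>(\<^sup>L\<^sup>)(1/z)\<close>
  carries the conclusion over. To treat both signs of \<open>z\<close> at once the identity is proved on the level of
  polynomials: the \<open>n\<close>-th derivative of \<open>Q(z) (1 + z\<^sup>2) powr (-3/2)\<close>, for a polynomial \<open>Q\<close>, is a
  polynomial times \<open>(1 + z\<^sup>2) powr (-3/2 - n)\<close>, and lemma \<open>deriv_numerator_monom_reciprocal\<close> relates
  these numerators for \<open>Q = z^(n + 2)\<close> and \<open>Q = 1\<close>.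

  If \<open>\<alpha> = 0\<close>, the conclusion holds because the function has a zero of order \<open>L + 2\<close> at \<open>0\<close>.
\<close>

section \<open>Derivatives of \<open>Q(z) (1 + z\<^sup>2) powr (-3/2)\<close>\<close>

text \<open>The recursion is the quotient rule, with the power \<open>(1 + z\<^sup>2) powr (3/2 + n + 1)\<close> as the common
  denominator.\<close>

primrec deriv_numerator :: "real poly \<Rightarrow> nat \<Rightarrow> real poly" where
  "deriv_numerator Q 0 = Q"
| "deriv_numerator Q (Suc n) =
     [:1, 0, 1:] * pderiv (deriv_numerator Q n) - [:0, 3 + 2 * real n:] * deriv_numerator Q n"

definition quotient_deriv :: "real poly \<Rightarrow> nat \<Rightarrow> real \<Rightarrow> real" where
  "quotient_deriv Q n z = poly (deriv_numerator Q n) z * (1 + z\<^sup>2) powr (- (3/2) - real n)"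

lemma has_real_derivative_quotient_deriv:
  "(quotient_deriv Q n has_real_derivative quotient_deriv Q (Suc n) z) (at z)"
proof -
  define N where "N = deriv_numerator Q n"
  define s where "s = - (3/2) - real n"
  have pos: "1 + z\<^sup>2 > 0"
    by (simp add: add_pos_nonneg)
  have "((\<lambda>z. poly N z * (1 + z\<^sup>2) powr s) has_real_derivative
      poly (pderiv N) z * (1 + z\<^sup>2) powr s + (s * (1 + z\<^sup>2) powr (s - 1) * (2 * z)) * poly N z) (at z)"
    using pos by (auto intro!: derivative_eq_intros poly_DERIV)
  moreover have "(1 + z\<^sup>2) powr s = (1 + z\<^sup>2) * (1 + z\<^sup>2) powr (s - 1)"
    using pos by (simp add: powr_mult_base)
  moreover have "s - 1 = - (3/2) - real (Suc n)"
    by (simp add: s_def)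
  moreover have "2 * s = - (3 + 2 * real n)"
    by (simp add: s_def)
  ultimately show ?thesis
    unfolding quotient_deriv_def[abs_def] N_def[symmetric] s_def[symmetric]
    by (elim DERIV_cong) (simp add: N_def[symmetric] s_def algebra_simps power2_eq_square)
qed

lemma higher_deriv_quotient:
  "(deriv ^^ n) (\<lambda>z. poly Q z / (1 + z\<^sup>2) powr (3/2)) = quotient_deriv Q n"
proof (induction n)
  case 0
  show ?case
    by (simp add: quotient_deriv_def powr_minus_divide)
next
  case (Suc n)
  then show ?case
    using DERIV_imp_deriv[OF has_real_derivative_quotient_deriv] by auto
qed

section \<open>The inversion identity for the numerators\<close>

text \<open>Leibniz rule for \<open>z f(z)\<close>: since \<open>z\<close> has derivative \<open>1\<close> and no higher ones,
  \<open>(z f)\<^sup>(\<^sup>n\<^sup>+\<^sup>1\<^sup>) = z f\<^sup>(\<^sup>n\<^sup>+\<^sup>1\<^sup>) + (n + 1) f\<^sup>(\<^sup>n\<^sup>)\<close>. The factor \<open>1 + z\<^sup>2\<close> puts the lower derivative over the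
  same denominator as the higher one.\<close>

lemma deriv_numerator_mult_X:
  "deriv_numerator ([:0, 1:] * Q) (Suc n) =
     [:0, 1:] * deriv_numerator Q (Suc n) + of_nat (Suc n) * [:1, 0, 1:] * deriv_numerator Q n"
proof (induction n)
  case 0
  show ?case
    by (simp add: pderiv_pCons pderiv_mult algebra_simps)
next
  case (Suc n)
  define A where "A = deriv_numerator Q n"
  define B where "B = deriv_numerator Q (Suc n)"
  have B: "poly B z = (1 + z * z) * poly (pderiv A) z - (3 + 2 * real n) * z * poly A z" for z
    by (simp add: A_def B_def algebra_simps)
  have "poly (deriv_numerator ([:0, 1:] * Q) (Suc (Suc n))) z =
      poly ([:0, 1:] * deriv_numerator Q (Suc (Suc n)) + of_nat (Suc (Suc n)) * [:1, 0, 1:] * B) z" for z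
  proof -
    have pd: "poly (pderiv ([:0, 1:] * B + of_nat (Suc n) * [:1, 0, 1:] * A)) z
        = poly B z + z * poly (pderiv B) z
          + real (Suc n) * (2 * z * poly A z + (1 + z * z) * poly (pderiv A) z)"
      by (simp add: pderiv_mult pderiv_add pderiv_pCons pderiv_smult algebra_simps)
    show ?thesis
      unfolding deriv_numerator.simps(2)[of _ "Suc n"] Suc.IH B_def[symmetric] A_def[symmetric]
      by (simp only: poly_diff poly_add poly_mult pd) (simp add: B algebra_simps)
  qed
  then show ?case
    unfolding B_def by (intro poly_eq_poly_eq_iff[THEN iffD1] ext)
qed

text \<open>The numerators on the diagonal, where the exponent \<open>n + 2\<close> of the monomial grows with the order \<open>n\<close>
  of the derivative, satisfy a recursion of their own: raising the exponent is the Leibniz rule,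
  raising the order is the quotient rule.\<close>

lemma deriv_numerator_monom_step:
  fixes n :: nat
  defines "S \<equiv> \<lambda>n. deriv_numerator (monom 1 (n + 2)) n"
  shows "poly (S (Suc n)) z = z * (1 + z\<^sup>2) * poly (pderiv (S n)) z
           - (3 + 2 * real n) * z\<^sup>2 * poly (S n) z + real (Suc n) * (1 + z\<^sup>2) * poly (S n) z"
proof -
  define Q :: "real poly" where "Q = monom 1 (n + 2)"
  have "monom 1 (Suc n + 2) = [:0, 1:] * Q"
    by (simp add: monom_Suc Q_def)
  then have "S (Suc n) = [:0, 1:] * deriv_numerator Q (Suc n) + of_nat (Suc n) * [:1, 0, 1:] * S n"
    unfolding S_def Q_def[symmetric] by (simp only: deriv_numerator_mult_X)
  moreover have "S n = deriv_numerator Q n"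
    by (simp add: S_def Q_def)
  ultimately show ?thesis
    by (simp add: algebra_simps power2_eq_square)
qed

text \<open>This is \<open>(d/dz)^n (z^(n - 1) \<phi>(1/z)) = (-1)^n z^(-n - 1) \<phi>\<^sup>(\<^sup>n\<^sup>)(1/z)\<close> for \<open>\<phi>(w) = (1 + w\<^sup>2) powr (-3/2)\<close>,
  freed of the powers of \<open>1 + z\<^sup>2\<close> and \<open>|z|\<close>. It holds because both sides satisfy the diagonal recursion;
  the induction hypothesis is differentiated to obtain the derivative that occurs there.\<close>

lemma deriv_numerator_monom_reciprocal:
  assumes "z \<noteq> 0"
  shows "poly (deriv_numerator (monom 1 (n + 2)) n) z =
           (-1) ^ n * z ^ (n + 2) * poly (deriv_numerator 1 n) (1 / z)"
  using assms
proof (induction n arbitrary: z)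
  case 0
  then show ?case by (simp add: poly_monom power2_eq_square)
next
  case (Suc n)
  define S where "S = deriv_numerator (monom 1 (n + 2)) n"
  define P where "P = deriv_numerator 1 n"
  \<comment> \<open>The right-hand side of the induction hypothesis is differentiated directly; it agrees with \<open>S\<close> only
    away from \<open>0\<close>, which is a neighbourhood of \<open>z\<close>.\<close>
  have "((\<lambda>z. (-1) ^ n * z ^ (n + 2) * poly P (1 / z)) has_real_derivative
      (-1) ^ n * ((real n + 2) * z ^ (n + 1) * poly P (1 / z) - z ^ n * poly (pderiv P) (1 / z))) (at z)"
  proof -
    have pow: "((\<lambda>z. z ^ (n + 2)) has_real_derivative (real n + 2) * z ^ (n + 1)) (at z)"
      using DERIV_pow[of "n + 2" z] by (simp add: add.commute)
    have "((\<lambda>z. 1 / z) has_real_derivative - (1 / z\<^sup>2)) (at z)"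
      using Suc.prems by (auto intro!: derivative_eq_intros simp: power2_eq_square)
    from DERIV_chain2[OF poly_DERIV this]
    have "((\<lambda>z. poly P (1 / z)) has_real_derivative poly (pderiv P) (1 / z) * - (1 / z\<^sup>2)) (at z)" .
    from DERIV_cmult[OF DERIV_mult[OF pow this], of "(-1) ^ n"]
    show ?thesis
      using Suc.prems by (simp add: mult.assoc) (elim DERIV_cong, simp add: power2_eq_square mult_ac)
  qed
  moreover have "eventually (\<lambda>z. (-1) ^ n * z ^ (n + 2) * poly P (1 / z) = poly S z) (nhds z)"
    by (rule eventually_mono[OF eventually_nhds_in_open[of "- {0}" z]])
       (use Suc in \<open>auto simp: S_def P_def\<close>)
  ultimately have "(poly S has_real_derivative
      (-1) ^ n * ((real n + 2) * z ^ (n + 1) * poly P (1 / z) - z ^ n * poly (pderiv P) (1 / z))) (at z)"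
    by (simp only: DERIV_cong_ev[OF refl _ refl])
  then have S': "poly (pderiv S) z = (-1) ^ n *
      ((real n + 2) * z ^ (n + 1) * poly P (1 / z) - z ^ n * poly (pderiv P) (1 / z))"
    using DERIV_unique poly_DERIV by blast
  have S: "poly S z = (-1) ^ n * z ^ (n + 2) * poly P (1 / z)"
    using Suc by (simp add: S_def P_def)
  show ?case
    using Suc.prems
    by (simp only: deriv_numerator_monom_step S_def[symmetric] S S')
       (simp add: P_def[symmetric] field_simps power2_eq_square)
qed

lemma deriv_numerator_monom_at_0:
  "poly (deriv_numerator (monom 1 (n + 2)) n) 0 = 0"
proof (induction n)
  case 0
  show ?case by (simp add: poly_monom)
next
  case (Suc n)
  then show ?case
    by (simp only: deriv_numerator_monom_step)
qed

section \<open>Moments and zeros\<close>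

text \<open>The definite description denotes: if the moments of orders \<open>0, \<dots>, M - 1\<close> all vanished, then
  \<open>\<Sum>j. a\<^sub>j P(x\<^sub>j) = 0\<close> for every polynomial \<open>P\<close> of degree below \<open>M\<close>, and a \<open>P\<close> vanishing at all nodes but one
  isolates a single coefficient.\<close>

lemma first_nonzero_moment:
  assumes "inj_on x {1..M}" and "\<exists>j\<in>{1..M}. a j \<noteq> 0"
  defines "L \<equiv> first_moment_index M x a"
  shows "\<forall>k<L. moment M x a k = 0" and "moment M x a L \<noteq> 0"
proof -
  obtain i where i: "i \<in> {1..M}" "a i \<noteq> 0"
    using assms(2) by blast
  have "\<exists>k\<le>M - 1. moment M x a k \<noteq> 0"
  proof (rule ccontr)
    assume "\<not> ?thesis"
    then have zero: "moment M x a k = 0" if "k \<le> M - 1" for k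
      using that by blast
    define P where "P = (\<Prod>j\<in>{1..M} - {i}. [:- x j, 1:])"
    have "degree P \<le> M - 1"
      using degree_prod_sum_le[of "{1..M} - {i}" "\<lambda>j. [:- x j, 1:]"] i
      by (simp add: P_def)
    have "(\<Sum>j=1..M. a j * poly P (x j)) = (\<Sum>j=1..M. \<Sum>k\<le>degree P. coeff P k * (a j * x j ^ k))"
      by (simp add: poly_altdef sum_distrib_left mult_ac)
    also have "\<dots> = (\<Sum>k\<le>degree P. coeff P k * moment M x a k)"
      unfolding moment_def sum_distrib_left by (rule sum.swap)
    also have "\<dots> = 0"
      using zero \<open>degree P \<le> M - 1\<close> by (intro sum.neutral) auto
    finally have "(\<Sum>j=1..M. a j * poly P (x j)) = 0" .
    moreover have "(\<Sum>j=1..M. a j * poly P (x j)) = (\<Sum>j\<in>{i}. a j * poly P (x j))"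
      using i by (intro sum.mono_neutral_right) (auto simp: P_def poly_prod)
    ultimately have "poly P (x i) = 0"
      using i by simp
    moreover have "poly [:- x j, 1:] (x i) \<noteq> 0" if "j \<in> {1..M} - {i}" for j
      using that i inj_onD[OF assms(1), of i j] by auto
    then have "poly P (x i) \<noteq> 0"
      unfolding P_def poly_prod by (subst prod_zero_iff) blast+
    ultimately show False
      by simp
  qed
  then have ex: "\<exists>k. k \<le> M - 1 \<and> moment M x a k \<noteq> 0"
    by blast
  define K where "K = (LEAST k. k \<le> M - 1 \<and> moment M x a k \<noteq> 0)"
  have K: "K \<le> M - 1" "moment M x a K \<noteq> 0"
    using LeastI_ex[OF ex] by (auto simp: K_def)
  have below: "\<forall>k<K. moment M x a k = 0"
    using not_less_Least K by (fastforce simp: K_def)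
  have "L = K"
    unfolding L_def first_moment_index_def
    using K below by (intro the_equality) (auto, metis nat_neq_iff)
  with K below show "\<forall>k<L. moment M x a k = 0" "moment M x a L \<noteq> 0"
    by auto
qed

text \<open>Taylor expansion at the moving point \<open>w\<^sub>m\<close> with increments \<open>- x\<^sub>j e\<^sub>m\<close>: the vanishing moments remove
  all terms below order \<open>L\<close>, and \<open>e\<^sub>m^L\<close> factors out of the Lagrange remainder, whose intermediate points
  tend to \<open>c\<close>.\<close>

lemma moment_mult_deriv_eq_0:
  fixes f :: "nat \<Rightarrow> real \<Rightarrow> real"
  assumes deriv: "\<And>n w. (f n has_real_derivative f (Suc n) w) (at w)"
    and w: "w \<longlonglongrightarrow> c" and e: "e \<longlonglongrightarrow> 0"
    and zero: "eventually (\<lambda>m. e m \<noteq> 0 \<and> (\<Sum>j=1..M. a j * f 0 (w m - x j * e m)) = 0) sequentially"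
    and low: "\<forall>k<L. moment M x a k = 0"
  shows "moment M x a L * f L c = 0"
proof -
  have taylor: "\<exists>t. \<bar>t\<bar> \<le> \<bar>h\<bar> \<and>
      f 0 (v + h) = (\<Sum>k<L. f k v / fact k * h ^ k) + f L (v + t) / fact L * h ^ L" for v h
  proof -
    have "((\<lambda>t. f n (v + t)) has_real_derivative f (Suc n) (v + t)) (at t)" for n t
      using DERIV_chain2[OF deriv DERIV_add[OF DERIV_const DERIV_ident]] by simp
    then show ?thesis
      using Maclaurin_all_le[of "\<lambda>n t. f n (v + t)" "\<lambda>t. f 0 (v + t)" h L] by auto
  qed
  \<comment> \<open>The intermediate points are \<open>w\<^sub>m + t\<^sub>j\<^sub>m\<close>.\<close>
  have "\<exists>t. \<forall>j m. \<bar>t j m\<bar> \<le> \<bar>- x j * e m\<bar> \<and>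
      f 0 (w m + (- x j * e m)) = (\<Sum>k<L. f k (w m) / fact k * (- x j * e m) ^ k)
        + f L (w m + t j m) / fact L * (- x j * e m) ^ L"
    by (intro choice allI taylor)
  then obtain t where t_le: "\<bar>t j m\<bar> \<le> \<bar>- x j * e m\<bar>"
    and t: "f 0 (w m + (- x j * e m)) = (\<Sum>k<L. f k (w m) / fact k * (- x j * e m) ^ k)
        + f L (w m + t j m) / fact L * (- x j * e m) ^ L" for j m
    by blast
  have "(\<lambda>m. w m + t j m) \<longlonglongrightarrow> c" for j
  proof -
    have "(\<lambda>m. \<bar>- x j * e m\<bar>) \<longlonglongrightarrow> 0"
      using tendsto_rabs[OF tendsto_mult[OF tendsto_const[of "- x j"] e]] by simp
    then have "t j \<longlonglongrightarrow> 0"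
      by (rule Lim_null_comparison[rotated]) (use t_le in auto)
    from tendsto_add[OF w this] show ?thesis by simp
  qed
  then have "(\<lambda>m. f L (w m + t j m)) \<longlonglongrightarrow> f L c" for j
    using isCont_tendsto_compose[OF DERIV_isCont[OF deriv]] by blast
  then have lim: "(\<lambda>m. \<Sum>j=1..M. a j * x j ^ L * f L (w m + t j m)) \<longlonglongrightarrow> (\<Sum>j=1..M. a j * x j ^ L * f L c)"
    by (intro tendsto_intros)
  have "eventually (\<lambda>m. (\<Sum>j=1..M. a j * x j ^ L * f L (w m + t j m)) = 0) sequentially"
    using zero
  proof eventually_elim
    case (elim m)
    have pow: "(- x j * e m) ^ k = (- e m) ^ k * x j ^ k" for j k
      by (simp flip: power_mult_distrib add: mult.commute)
    have "0 = (\<Sum>j=1..M. a j * f 0 (w m + (- x j * e m)))"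
      using elim by simp
    also have "\<dots> = (\<Sum>j=1..M. a j * (\<Sum>k<L. f k (w m) / fact k * (- x j * e m) ^ k))
        + (\<Sum>j=1..M. a j * (f L (w m + t j m) / fact L * (- x j * e m) ^ L))"
      by (simp only: t distrib_left sum.distrib)
    also have "(\<Sum>j=1..M. a j * (\<Sum>k<L. f k (w m) / fact k * (- x j * e m) ^ k))
        = (\<Sum>j=1..M. \<Sum>k<L. f k (w m) / fact k * (- e m) ^ k * (a j * x j ^ k))"
      by (simp only: pow sum_distrib_left) (simp add: mult_ac)
    also have "\<dots> = (\<Sum>k<L. f k (w m) / fact k * (- e m) ^ k * moment M x a k)"
      unfolding moment_def sum_distrib_left by (rule sum.swap)
    also have "\<dots> = 0"
      using low by simp
    also have "(\<Sum>j=1..M. a j * (f L (w m + t j m) / fact L * (- x j * e m) ^ L))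
        = (- e m) ^ L / fact L * (\<Sum>j=1..M. a j * x j ^ L * f L (w m + t j m))"
      by (simp only: pow sum_distrib_left) (simp add: mult_ac)
    finally show ?case
      using elim by simp
  qed
  then have "(\<Sum>j=1..M. a j * x j ^ L * f L c) = 0"
    using tendsto_unique[OF _ lim] tendsto_eventually by force
  then show ?thesis
    by (simp add: moment_def sum_distrib_right)
qed

text \<open>The summands of \<open>Y\<close> are homogeneous of degree \<open>-2\<close> in \<open>(u - x\<^sub>j, v)\<close>. The sign
  of \<open>q\<close> stays in the argument of the even function \<open>\<phi>\<close>, where it keeps the slope \<open>p / q\<close> visible.\<close>

lemma Y_scaled:
  assumes "q \<noteq> 0"
  shows "Y M x a p q = q / \<bar>q\<bar> powr 3 * (\<Sum>j=1..M. a j * quotient_deriv 1 0 (p / q - x j * (1 / q)))"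
proof -
  have "a j * q / ((p - x j)\<^sup>2 + q\<^sup>2) powr (3/2)
      = q / \<bar>q\<bar> powr 3 * (a j * quotient_deriv 1 0 (p / q - x j * (1 / q)))" for j
  proof -
    have "(p - x j)\<^sup>2 + q\<^sup>2 = q\<^sup>2 * (1 + (p / q - x j * (1 / q))\<^sup>2)"
      using assms by (simp add: field_simps power2_eq_square)
    moreover have "(q\<^sup>2) powr (3/2) = \<bar>q\<bar> powr 3"
      using assms powr_powr[of "\<bar>q\<bar>" 2 "3/2"] by simp
    ultimately have "((p - x j)\<^sup>2 + q\<^sup>2) powr (3/2)
        = \<bar>q\<bar> powr 3 * (1 + (p / q - x j * (1 / q))\<^sup>2) powr (3/2)"
      by (simp add: powr_mult)
    then show ?thesis
      by (simp flip: fun_cong[OF higher_deriv_quotient[of 0 1]])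
  qed
  then show ?thesis
    by (simp add: Y_def sum_distrib_left)
qed

theorem proposition2p7:
  fixes M L :: nat and x a p q :: "nat \<Rightarrow> real" and \<delta> \<alpha> :: real
  assumes "M \<ge> 1"
    and "0 < x 1" and "strict_mono_on {1..M} x"
    and "\<exists>j\<in>{1..M}. a j \<noteq> 0"
    and "L = first_moment_index M x a"
    and "0 < \<delta>" and "\<delta> < 1/4"
    and "\<And>m. m \<ge> 1 \<Longrightarrow> Y M x a (p m) (q m) = 0"
    and "\<And>m. m \<ge> 1 \<Longrightarrow> \<bar>p m\<bar> > x M"
    and "\<And>m. m \<ge> 1 \<Longrightarrow> q m \<noteq> 0"
    and "\<And>m. m \<ge> 1 \<Longrightarrow> \<bar>q m / p m\<bar> < 1 - 2 * \<delta>"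
    and "filterlim (\<lambda>m. \<bar>p m\<bar>) at_top sequentially"
    and "(\<lambda>m. q m / p m) \<longlonglongrightarrow> \<alpha>"
  shows "(deriv ^^ L) (\<lambda>z::real. z ^ (L + 2) / (1 + z\<^sup>2) powr (3/2)) \<alpha> = 0"
proof -
  have "poly (deriv_numerator (monom 1 (L + 2)) L) \<alpha> = 0"
  proof (cases "\<alpha> = 0")
    case True
    then show ?thesis
      by (simp only: deriv_numerator_monom_at_0)
  next
    case False
    have inj: "inj_on x {1..M}"
      using assms(3) by (rule strict_mono_on_imp_inj_on)
    note moments = first_nonzero_moment[OF inj assms(4), folded assms(5)]
    have slope: "(\<lambda>m. p m / q m) \<longlonglongrightarrow> 1 / \<alpha>"
      using tendsto_divide[OF tendsto_const[of 1] assms(13) False] by simp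
    have "(\<lambda>m. inverse (p m)) \<longlonglongrightarrow> 0"
      using tendsto_inverse_0_at_top[OF assms(12)]
      by (simp add: tendsto_rabs_zero_iff flip: abs_inverse)
    then have "(\<lambda>m. p m / q m * inverse (p m)) \<longlonglongrightarrow> 1 / \<alpha> * 0"
      by (intro tendsto_mult slope)
    moreover have "eventually (\<lambda>m. p m / q m * inverse (p m) = 1 / q m) sequentially"
      using filterlim_at_top_dense[THEN iffD1, OF assms(12), rule_format, of 0]
      by eventually_elim (auto simp: field_simps)
    ultimately have "(\<lambda>m. 1 / q m) \<longlonglongrightarrow> 1 / \<alpha> * 0"
      by (rule Lim_transform_eventually)
    then have scale: "(\<lambda>m. 1 / q m) \<longlonglongrightarrow> 0"
      by simp
    have zero: "eventually (\<lambda>m. 1 / q m \<noteq> 0 \<and>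
        (\<Sum>j=1..M. a j * quotient_deriv 1 0 (p m / q m - x j * (1 / q m))) = 0) sequentially"
      using eventually_ge_at_top[of 1]
    proof eventually_elim
      case (elim m)
      then show ?case
        using assms(8)[of m] assms(10)[of m] by (simp add: Y_scaled)
    qed
    have "moment M x a L * quotient_deriv 1 L (1 / \<alpha>) = 0"
      using has_real_derivative_quotient_deriv slope scale zero moments(1)
      by (rule moment_mult_deriv_eq_0)
    then have "poly (deriv_numerator 1 L) (1 / \<alpha>) = 0"
      using moments(2) by (auto simp: quotient_deriv_def add_nonneg_eq_0_iff)
    then show ?thesis
      by (simp only: deriv_numerator_monom_reciprocal[OF False] mult_zero_right)
  qed
  then have "quotient_deriv (monom 1 (L + 2)) L \<alpha> = 0"
    by (simp add: quotient_deriv_def)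
  then show ?thesis
    using higher_deriv_quotient[of L "monom 1 (L + 2)"] by (simp add: poly_monom)
qed

end
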